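(* Let $p_2\in\{1,-1\}$ and $\rho>0$, and consider the system $$\mathcal{D}'=2p_2\mathcal{I}\mathcal{R},\qquad\mathcal{R}'=-2p_2\mathcal{I}\mathcal{D},\qquad\mathcal{I}'=0$$ on $S_\rho^2$. The set of all fixed points is $\{(\rho\cos\theta,\rho\sin\theta,0):\theta\in\mathbb{R}/2\pi\mathbb{Z}\}\cup\{(0,0,\pm\rho)\}$. The solution is given by $$\mathcal{D}(\tau)=\mathcal{D}(0)\cos(2p_2\tau\mathcal{I}(0))+\mathcal{R}(0)\sin(2p_2\tau\mathcal{I}(0)),$$ $$\mathcal{R}(\tau)=-\mathcal{D}(0)\sin(2p_2\tau\mathcal{I}(0))+\mathcal{R}(0)\cos(2p_2\tau\mathcal{I}(0)),$$ $$\mathcal{I}(\tau)=\mathcal{I}(0).$$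
   Context: $S^2_\rho=\{(x,y,z)\in\mathbb{R}^3: x^2+y^2+z^2=\rho^2\}$; the unknown $(\mathcal{D},\mathcal{R},\mathcal{I})$ is real valued with initial data in $S_\rho^2$, $\tau\in\mathbb{R}$, and the system preserves $S^2_\rho$. *)

theory Defs
  imports "HOL-Analysis.Analysis"
begin

definition S2 :: "real \<Rightarrow> (real \<times> real \<times> real) set" where
  "S2 \<rho> = {(x, y, z). x\<^sup>2 + y\<^sup>2 + z\<^sup>2 = \<rho>\<^sup>2}"

(* The state is the triple (D, R, I); S2 is invariant under the flow of this field. *)
definition vfield :: "real \<Rightarrow> real \<times> real \<times> real \<Rightarrow> real \<times> real \<times> real" where
  "vfield p2 = (\<lambda>(D, R, I). (2 * p2 * I * R, - 2 * p2 * I * D, 0))"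

definition solution :: "real \<Rightarrow> (real \<Rightarrow> real \<times> real \<times> real) \<Rightarrow> bool" where
  "solution p2 u \<longleftrightarrow> (\<forall>\<tau>. (u has_vector_derivative vfield p2 (u \<tau>)) (at \<tau>))"

definition fixed_points :: "real \<Rightarrow> real \<Rightarrow> (real \<times> real \<times> real) set" where
  "fixed_points p2 \<rho> = {w \<in> S2 \<rho>. vfield p2 w = 0}"

end

theory Submission
  imports Defs
begin

text \<open>
  The component \<open>I\<close> is conserved, so the system is a rotation of the \<open>(D, R)\<close>-plane with constant
  angular velocity \<open>2 * p2 * I\<close>. Uniqueness follows because the solution rotated back by this angle
  has vanishing derivative.
\<close>

text \<open>In the \<open>(D, R)\<close>-plane this is the clockwise rotation by
  \<open>2 * p2 * \<tau> * I0\<close>. Time is the last argument, so that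
  \<open>rotation_flow p2 w\<close> is itself a candidate solution.\<close>

definition rotation_flow :: "real \<Rightarrow> real \<times> real \<times> real \<Rightarrow> real \<Rightarrow> real \<times> real \<times> real" where
  "rotation_flow p2 = (\<lambda>(D0, R0, I0) \<tau>.
     (D0 * cos (2 * p2 * \<tau> * I0) + R0 * sin (2 * p2 * \<tau> * I0),
      - D0 * sin (2 * p2 * \<tau> * I0) + R0 * cos (2 * p2 * \<tau> * I0),
      I0))"

text \<open>Projections are bounded linear and pairing respects derivatives. This splits the system
  into scalar equations, to which the rules for real derivatives apply.\<close>

lemma has_vector_derivative_triple_iff:
  fixes f g h :: "real \<Rightarrow> real"
  shows "((\<lambda>t. (f t, g t, h t)) has_vector_derivative (a, b, c)) (at x within S) \<longleftrightarrow>
    (f has_real_derivative a) (at x within S) \<and> (g has_real_derivative b) (at x within S) \<and> (h has_real_derivative c) (at x within S)"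
    (is "?L \<longleftrightarrow> ?R")
proof
  assume L: ?L
  note snd = bounded_linear.has_vector_derivative[OF bounded_linear_snd L]
  show ?R
    using bounded_linear.has_vector_derivative[OF bounded_linear_fst L]
      bounded_linear.has_vector_derivative[OF bounded_linear_fst snd]
      bounded_linear.has_vector_derivative[OF bounded_linear_snd snd]
    by (simp add: has_real_derivative_iff_has_vector_derivative)
next
  assume ?R
  then show ?L
    by (simp add: has_real_derivative_iff_has_vector_derivative has_vector_derivative_Pair)
qed

lemma solution_triple_iff:
  "solution p2 (\<lambda>t. (D t, R t, I t)) \<longleftrightarrow>
    (\<forall>t. (D has_real_derivative 2 * p2 * I t * R t) (at t) \<and>
         (R has_real_derivative - 2 * p2 * I t * D t) (at t) \<and>
         (I has_real_derivative 0) (at t))"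
  by (simp add: solution_def vfield_def has_vector_derivative_triple_iff)

lemma solution_rotation_flow: "solution p2 (rotation_flow p2 w)"
proof -
  obtain D0 R0 I0 where w: "w = (D0, R0, I0)" by (cases w) auto
  show ?thesis
    unfolding w rotation_flow_def prod.case solution_triple_iff
    by (auto intro!: derivative_eq_intros simp: algebra_simps)
qed

lemma rotation_flow_0: "rotation_flow p2 w 0 = w"
  by (auto simp: rotation_flow_def split: prod.splits)

text \<open>Here \<open>s\<close> and \<open>c\<close> stand for sine and cosine:
  \<open>(a, b)\<close> is \<open>(x, y)\<close> turned counterclockwise, and the transposed matrix
  undoes the turn up to the factor \<open>s\<^sup>2 + c\<^sup>2\<close>.\<close>

lemma rotation_inverse:
  fixes x y s c :: "'a :: comm_ring_1"
  assumes unit: "s\<^sup>2 + c\<^sup>2 = 1" and a: "x * c - y * s = a" and b: "x * s + y * c = b"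
  shows "x = a * c + b * s" and "y = - a * s + b * c"
proof -
  have "a * c + b * s = x * (s\<^sup>2 + c\<^sup>2)" "- a * s + b * c = y * (s\<^sup>2 + c\<^sup>2)"
    unfolding a[symmetric] b[symmetric] by (simp_all add: algebra_simps power2_eq_square)
  then show "x = a * c + b * s" and "y = - a * s + b * c"
    by (simp_all add: unit)
qed

text \<open>The mixed terms \<open>x * y * s * c\<close> cancel. This is what keeps the flow on the
  sphere.\<close>

lemma rotation_norm:
  fixes x y s c :: "'a :: comm_ring_1"
  assumes unit: "s\<^sup>2 + c\<^sup>2 = 1"
  shows "(x * c + y * s)\<^sup>2 + (- x * s + y * c)\<^sup>2 = x\<^sup>2 + y\<^sup>2"
proof -
  have "(x * c + y * s)\<^sup>2 + (- x * s + y * c)\<^sup>2 = (x\<^sup>2 + y\<^sup>2) * (s\<^sup>2 + c\<^sup>2)"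
    by (simp add: algebra_simps power2_eq_square)
  then show ?thesis by (simp add: unit)
qed

lemma solution_eq_rotation_flow:
  assumes "solution p2 u"
  shows "u = rotation_flow p2 (u 0)"
proof -
  define D R I where "D = (\<lambda>t. fst (u t))" and "R = (\<lambda>t. fst (snd (u t)))"
    and "I = (\<lambda>t. snd (snd (u t)))"
  have u: "u = (\<lambda>t. (D t, R t, I t))"
    by (simp add: D_def R_def I_def)
  have D': "(D has_real_derivative 2 * p2 * I t * R t) (at t)"
    and R': "(R has_real_derivative - 2 * p2 * I t * D t) (at t)"
    and I': "(I has_real_derivative 0) (at t)" for t
    using assms unfolding u solution_triple_iff by blast+
  have I: "I t = I 0" for t
    using I' by (intro DERIV_isconst_all) blast
  have rotate_back:
    "D t * cos (2 * p2 * t * I 0) - R t * sin (2 * p2 * t * I 0) = D 0"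
    "D t * sin (2 * p2 * t * I 0) + R t * cos (2 * p2 * t * I 0) = R 0" for t
  proof -
    \<comment> \<open>Freezing \<open>I\<close> at its initial value makes the system linear with
      constant coefficients that match the derivative of the angle
      \<open>2 * p2 * t * I 0\<close>.\<close>
    have deriv: "(D has_real_derivative 2 * p2 * I 0 * R s) (at s)"
      "(R has_real_derivative - 2 * p2 * I 0 * D s) (at s)" for s
      using D'[of s] R'[of s] by (simp_all add: I[of s])
    \<comment> \<open>By the product rule, the terms from \<open>D\<close> and \<open>R\<close>
      cancel in pairs against those from the cosine and sine.\<close>
    have "((\<lambda>t. D t * cos (2 * p2 * t * I 0) - R t * sin (2 * p2 * t * I 0))
        has_real_derivative 0) (at s)" for s
      by (auto intro!: derivative_eq_intros deriv simp: algebra_simps)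
    then show "D t * cos (2 * p2 * t * I 0) - R t * sin (2 * p2 * t * I 0) = D 0"
      using DERIV_isconst_all[of "\<lambda>t. D t * cos (2 * p2 * t * I 0) - R t * sin (2 * p2 * t * I 0)" t 0]
      by simp
    have "((\<lambda>t. D t * sin (2 * p2 * t * I 0) + R t * cos (2 * p2 * t * I 0))
        has_real_derivative 0) (at s)" for s
      by (auto intro!: derivative_eq_intros deriv simp: algebra_simps)
    then show "D t * sin (2 * p2 * t * I 0) + R t * cos (2 * p2 * t * I 0) = R 0"
      using DERIV_isconst_all[of "\<lambda>t. D t * sin (2 * p2 * t * I 0) + R t * cos (2 * p2 * t * I 0)" t 0]
      by simp
  qed
  show ?thesis
  proof
    fix t
    have "D t = D 0 * cos (2 * p2 * t * I 0) + R 0 * sin (2 * p2 * t * I 0)"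
      "R t = - D 0 * sin (2 * p2 * t * I 0) + R 0 * cos (2 * p2 * t * I 0)"
      using rotation_inverse[OF sin_cos_squared_add rotate_back[of t]] by simp_all
    then show "u t = rotation_flow p2 (u 0) t"
      using I[of t] by (simp add: u rotation_flow_def)
  qed
qed

lemma rotation_flow_in_S2:
  assumes "w \<in> S2 \<rho>"
  shows "rotation_flow p2 w \<tau> \<in> S2 \<rho>"
proof -
  obtain D0 R0 I0 where w: "w = (D0, R0, I0)" by (cases w) auto
  show ?thesis
    using assms rotation_norm[OF sin_cos_squared_add, of D0 "2 * p2 * \<tau> * I0" R0]
    by (simp add: w S2_def rotation_flow_def)
qed

text \<open>Since \<open>p2\<close> is nonzero, the field vanishes iff
  \<open>I * R = I * D = 0\<close>: either \<open>I = 0\<close>, the equator, or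
  \<open>D = R = 0\<close>, where the sphere equation leaves only the poles.\<close>

lemma fixed_points_eq:
  assumes "p2 \<noteq> 0"
  shows "fixed_points p2 \<rho> =
    {(\<rho> * cos \<theta>, \<rho> * sin \<theta>, 0) | \<theta>. True} \<union> {(0, 0, \<rho>), (0, 0, - \<rho>)}"
    (is "_ = ?equator \<union> ?poles")
proof (intro equalityI subsetI)
  fix w assume w: "w \<in> fixed_points p2 \<rho>"
  obtain x y z where xyz: "w = (x, y, z)" by (cases w) auto
  have sphere: "x\<^sup>2 + y\<^sup>2 + z\<^sup>2 = \<rho>\<^sup>2" and z: "z = 0 \<or> (x = 0 \<and> y = 0)"
    using w assms by (auto simp: xyz fixed_points_def S2_def vfield_def zero_prod_def)
  show "w \<in> ?equator \<union> ?poles"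
  proof (cases "z = 0")
    case True
    show ?thesis
    \<comment> \<open>Rescaling to the unit circle, which supplies the angle, requires a nonzero
      radius; at radius zero the sphere is just the origin.\<close>
    proof (cases "\<rho> = 0")
      case True
      then show ?thesis using sphere \<open>z = 0\<close> by (auto simp: xyz)
    next
      case False
      then have "(x / \<rho>)\<^sup>2 + (y / \<rho>)\<^sup>2 = 1"
        using sphere True by (simp add: power_divide flip: add_divide_distrib)
      then obtain \<theta> where "x / \<rho> = cos \<theta>" "y / \<rho> = sin \<theta>"
        using sincos_total_2pi by metis
      then have "w = (\<rho> * cos \<theta>, \<rho> * sin \<theta>, 0)"
        using False True by (simp add: xyz field_simps)
      then show ?thesis by blast
    qed
  next
    case False
    then show ?thesis using z sphere by (auto simp: xyz power2_eq_iff)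
  qed
next
  fix w assume "w \<in> ?equator \<union> ?poles"
  then show "w \<in> fixed_points p2 \<rho>"
    \<comment> \<open>Factoring out \<open>\<rho>\<^sup>2\<close> exposes the sum of squares of
      cosine and sine.\<close>
    by (auto simp: fixed_points_def S2_def vfield_def zero_prod_def power_mult_distrib
        simp flip: distrib_left)
qed

theorem proposition2p3:
  fixes p2 \<rho> :: real
  assumes "p2 \<in> {1, -1}" and "\<rho> > 0"
  shows "fixed_points p2 \<rho> =
           {(\<rho> * cos \<theta>, \<rho> * sin \<theta>, 0) | \<theta>. True} \<union> {(0, 0, \<rho>), (0, 0, - \<rho>)}
       \<and> (\<forall>u. solution p2 u \<and> u 0 \<in> S2 \<rho> \<longrightarrow> (\<forall>\<tau>. u \<tau> \<in> S2 \<rho>))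
       \<and> (\<forall>D0 R0 I0. (D0, R0, I0) \<in> S2 \<rho> \<longrightarrow>
           (\<forall>u. solution p2 u \<and> u 0 = (D0, R0, I0) \<longleftrightarrow>
             u = (\<lambda>\<tau>. (D0 * cos (2 * p2 * \<tau> * I0) + R0 * sin (2 * p2 * \<tau> * I0),
                       - D0 * sin (2 * p2 * \<tau> * I0) + R0 * cos (2 * p2 * \<tau> * I0),
                       I0))))"
proof -
  have "p2 \<noteq> 0" using assms by auto
  \<comment> \<open>Invariance of the sphere is read off the explicit flow, with which every
    solution coincides.\<close>
  moreover have "u \<tau> \<in> S2 \<rho>" if "solution p2 u" "u 0 \<in> S2 \<rho>" for u \<tau>
    using rotation_flow_in_S2[OF that(2)] solution_eq_rotation_flow[OF that(1)] by metis
  \<comment> \<open>Left to right is uniqueness; right to left is existence with the prescribed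
    initial state.\<close>
  moreover have "solution p2 u \<and> u 0 = w \<longleftrightarrow> u = rotation_flow p2 w" for u w
    using solution_eq_rotation_flow solution_rotation_flow rotation_flow_0 by metis
  ultimately show ?thesis
    using fixed_points_eq by (simp add: rotation_flow_def)
qed

end
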